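(* Let $G=(V,E)$ be a finite connected simple undirected graph and let $\rho$ be a choice function on $V$. Then for every choice function $\rho'$ on $V$ the following are equivalent: (i) $cl_{\rho}(G)$ is Hamiltonian; (ii) $G$ is Hamiltonian; (iii) $cl_{\rho'}(G)$ is Hamiltonian.
   Context: Graphs are finite, simple, undirected and connected; an edge $\{x,y\}$ is written $xy$. A graph is Hamiltonian if it contains a cycle (of length at least $3$) through every vertex exactly once. For a graph $G=(V,E)$ and $x\in V$: $N(x)=\{y: xy\in E\}$, $N[x]=N(x)\cup\{x\}$; for $X\subseteq V$, $N[X]=\bigcup_{x\in X}N[x]$, $N(X)=N[X]\setminus X$, and $E(X)=\{xy\in E: x,y\in X\}$, $\sigma(X)=|E(X)|$. Two vertices $x,y$ are neighborhood-equivalent if $N[x]=N[y]$; $\bar x$ denotes the equivalence class of $x$. A vertex $x$ is simplicial if $N[x]$ is a clique. Define $\chi_2(x)=\min(\sigma(N(\bar x)),2)$. A vertex $x$ of $G$ is N2-eligible (in $G$) if $x$ is non-simplicial and $|\bar x|\ge |N(\bar x)|-\chi_2(x)$. The local completion of $G$ at $x$ is the graph $G_x=(V,E\cup B_x)$, where $B_x=\{yz: y\ne z,\ yz\notin E,\ y,z\in N(\bar x)\}$. A choice function on $V$ is a function $\rho:\mathcal P(V)\to V$ with $\rho(X)\in X$ for every non-empty $X\subseteq V$. The N2-closure $cl_\rho(G)$ is defined recursively (on the number of non-simplicial vertices, which strictly decreases at each step): if $G$ has no N2-eligible vertex, then $cl_\rho(G)=G$; otherwise, letting $\nu$ be the set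 of N2-eligible vertices of $G$ and $x=\rho(\nu)$, $cl_\rho(G)=cl_\rho(G_x)$. *)

theory Defs
  imports Main "HOL-Library.FuncSet"
begin

text \<open>A graph is a pair of a vertex set and a set of edges; the edge \<open>xy\<close> is the set \<open>{x, y}\<close>.\<close>

type_synonym 'a graph = "'a set \<times> 'a set set"

abbreviation verts :: "'a graph \<Rightarrow> 'a set" where
  "verts G \<equiv> fst G"

abbreviation edges :: "'a graph \<Rightarrow> 'a set set" where
  "edges G \<equiv> snd G"

definition simple_graph :: "'a graph \<Rightarrow> bool" where
  "simple_graph G \<longleftrightarrow> finite (verts G) \<and> (\<forall>e \<in> edges G. e \<subseteq> verts G \<and> card e = 2)"

definition connected_graph :: "'a graph \<Rightarrow> bool" where
  "connected_graph G \<longleftrightarrow>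
     (\<forall>x \<in> verts G. \<forall>y \<in> verts G. (x, y) \<in> {(u, v). {u, v} \<in> edges G}\<^sup>*)"

definition is_cycle :: "'a graph \<Rightarrow> 'a list \<Rightarrow> bool" where
  "is_cycle G vs \<longleftrightarrow> length vs \<ge> 3 \<and> distinct vs \<and> set vs \<subseteq> verts G \<and>
     (\<forall>i < length vs. {vs ! i, vs ! (Suc i mod length vs)} \<in> edges G)"

definition hamiltonian :: "'a graph \<Rightarrow> bool" where
  "hamiltonian G \<longleftrightarrow> (\<exists>vs. is_cycle G vs \<and> set vs = verts G)"

definition nbhd :: "'a graph \<Rightarrow> 'a \<Rightarrow> 'a set" where
  "nbhd G x = {y. {x, y} \<in> edges G}"

definition closed_nbhd :: "'a graph \<Rightarrow> 'a \<Rightarrow> 'a set" where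
  "closed_nbhd G x = nbhd G x \<union> {x}"

definition closed_nbhd_set :: "'a graph \<Rightarrow> 'a set \<Rightarrow> 'a set" where
  "closed_nbhd_set G X = (\<Union>x \<in> X. closed_nbhd G x)"

definition nbhd_set :: "'a graph \<Rightarrow> 'a set \<Rightarrow> 'a set" where
  "nbhd_set G X = closed_nbhd_set G X - X"

definition induced_edges :: "'a graph \<Rightarrow> 'a set \<Rightarrow> 'a set set" where
  "induced_edges G X = {e \<in> edges G. e \<subseteq> X}"

definition sigma :: "'a graph \<Rightarrow> 'a set \<Rightarrow> nat" where
  "sigma G X = card (induced_edges G X)"

definition nbhd_class :: "'a graph \<Rightarrow> 'a \<Rightarrow> 'a set" where
  "nbhd_class G x = {y \<in> verts G. closed_nbhd G y = closed_nbhd G x}"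

definition is_clique :: "'a graph \<Rightarrow> 'a set \<Rightarrow> bool" where
  "is_clique G X \<longleftrightarrow> (\<forall>u \<in> X. \<forall>v \<in> X. u \<noteq> v \<longrightarrow> {u, v} \<in> edges G)"

definition simplicial :: "'a graph \<Rightarrow> 'a \<Rightarrow> bool" where
  "simplicial G x \<longleftrightarrow> is_clique G (closed_nbhd G x)"

definition chi2 :: "'a graph \<Rightarrow> 'a \<Rightarrow> nat" where
  "chi2 G x = min (sigma G (nbhd_set G (nbhd_class G x))) 2"

definition N2_eligible :: "'a graph \<Rightarrow> 'a \<Rightarrow> bool" where
  "N2_eligible G x \<longleftrightarrow> x \<in> verts G \<and> \<not> simplicial G x \<and>
     int (card (nbhd_class G x)) \<ge> int (card (nbhd_set G (nbhd_class G x))) - int (chi2 G x)"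

definition completion_edges :: "'a graph \<Rightarrow> 'a \<Rightarrow> 'a set set" where
  "completion_edges G x =
     {{y, z} | y z. y \<noteq> z \<and> {y, z} \<notin> edges G \<and>
        y \<in> nbhd_set G (nbhd_class G x) \<and> z \<in> nbhd_set G (nbhd_class G x)}"

definition local_completion :: "'a graph \<Rightarrow> 'a \<Rightarrow> 'a graph" where
  "local_completion G x = (verts G, edges G \<union> completion_edges G x)"

definition choice_function :: "'a set \<Rightarrow> ('a set \<Rightarrow> 'a) \<Rightarrow> bool" where
  "choice_function V \<rho> \<longleftrightarrow> \<rho> \<in> Pow V \<rightarrow> V \<and> (\<forall>X \<subseteq> V. X \<noteq> {} \<longrightarrow> \<rho> X \<in> X)"

text \<open>
  The recursion terminates whenever \<open>G\<close> is a simple graph and \<open>\<rho>\<close> is a choice function on its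
  vertices; the lemmas below show that every step stays within simple graphs on the same vertices
  and strictly decreases the number of non-simplicial vertices.
\<close>

partial_function (tailrec) N2_closure :: "('a set \<Rightarrow> 'a) \<Rightarrow> 'a graph \<Rightarrow> 'a graph" where
  "N2_closure \<rho> G =
     (if \<not> (\<exists>x. N2_eligible G x) then G
      else N2_closure \<rho> (local_completion G (\<rho> {x. N2_eligible G x})))"

lemma verts_local_completion [simp]: "verts (local_completion G x) = verts G"
  by (simp add: local_completion_def)

lemma nbhd_sym: "y \<in> nbhd G x \<longleftrightarrow> x \<in> nbhd G y"
  by (simp add: nbhd_def insert_commute)

lemma nbhd_subset_verts: "simple_graph G \<Longrightarrow> nbhd G x \<subseteq> verts G"
  by (auto simp: simple_graph_def nbhd_def)

lemma nbhd_set_nbhd_class: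
  assumes "x \<in> verts G"
  shows "nbhd_set G (nbhd_class G x) = closed_nbhd G x - nbhd_class G x"
  using assms by (auto simp: nbhd_set_def closed_nbhd_set_def nbhd_class_def)

lemma simple_graph_local_completion:
  assumes G: "simple_graph G" and x: "x \<in> verts G"
  shows "simple_graph (local_completion G x)"
proof -
  have "nbhd_set G (nbhd_class G x) \<subseteq> verts G"
    using x nbhd_subset_verts[OF G, of x] by (auto simp: nbhd_set_nbhd_class closed_nbhd_def)
  then show ?thesis
    using G by (auto simp: simple_graph_def local_completion_def completion_edges_def)
qed

lemma edge_local_completion_iff:
  "{u, v} \<in> edges (local_completion G x) \<longleftrightarrow> {u, v} \<in> edges G \<or>
     (u \<noteq> v \<and> u \<in> nbhd_set G (nbhd_class G x) \<and> v \<in> nbhd_set G (nbhd_class G x))"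
  by (auto simp: local_completion_def completion_edges_def doubleton_eq_iff)

lemma is_clique_local_completion:
  assumes x: "x \<in> verts G"
  shows "is_clique (local_completion G x) (closed_nbhd G x)"
  unfolding is_clique_def
proof (intro ballI impI)
  fix u v assume uv: "u \<in> closed_nbhd G x" "v \<in> closed_nbhd G x" "u \<noteq> v"
  have cls: "{a, b} \<in> edges G"
    if "a \<in> nbhd_class G x" "b \<in> closed_nbhd G x" "a \<noteq> b" for a b
  proof -
    have "b \<in> closed_nbhd G a" using that by (auto simp: nbhd_class_def)
    then show ?thesis using that(3) by (auto simp: closed_nbhd_def nbhd_def)
  qed
  show "{u, v} \<in> edges (local_completion G x)"
    using cls[of u v] cls[of v u] uv x
    by (auto simp: edge_local_completion_iff nbhd_set_nbhd_class insert_commute)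
qed

lemma simplicial_local_completion_self:
  assumes x: "x \<in> verts G"
  shows "simplicial (local_completion G x) x"
proof -
  have "x \<notin> nbhd_set G (nbhd_class G x)"
    using x by (auto simp: nbhd_set_def nbhd_class_def)
  then have "closed_nbhd (local_completion G x) x = closed_nbhd G x"
    by (auto simp: closed_nbhd_def nbhd_def edge_local_completion_iff)
  then show ?thesis
    using is_clique_local_completion[OF x] by (simp add: simplicial_def)
qed

lemma simplicial_local_completion:
  assumes x: "x \<in> verts G" and y: "simplicial G y"
  shows "simplicial (local_completion G x) y"
proof (cases "y \<in> nbhd_set G (nbhd_class G x)")
  case True
  then have "x \<in> closed_nbhd G y" and yx: "y \<in> closed_nbhd G x"
    using x nbhd_sym[of y G x] by (auto simp: nbhd_set_nbhd_class closed_nbhd_def)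
  then have "closed_nbhd G y \<subseteq> closed_nbhd G x"
    using y by (auto simp: simplicial_def is_clique_def closed_nbhd_def nbhd_def)
  then have "closed_nbhd (local_completion G x) y \<subseteq> closed_nbhd G x"
    using x yx by (auto simp: closed_nbhd_def nbhd_def edge_local_completion_iff nbhd_set_nbhd_class)
  then show ?thesis
    using is_clique_local_completion[OF x] by (auto simp: simplicial_def is_clique_def)
next
  case False
  then have "closed_nbhd (local_completion G x) y = closed_nbhd G y"
    by (auto simp: closed_nbhd_def nbhd_def edge_local_completion_iff)
  then show ?thesis
    using y by (auto simp: simplicial_def is_clique_def edge_local_completion_iff)
qed

lemma card_non_simplicial_local_completion:
  assumes G: "simple_graph G" and x: "N2_eligible G x"
  shows "card {y \<in> verts (local_completion G x). \<not> simplicial (local_completion G x) y}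
           < card {y \<in> verts G. \<not> simplicial G y}"
proof (rule psubset_card_mono)
  show "finite {y \<in> verts G. \<not> simplicial G y}"
    using G by (simp add: simple_graph_def)
  have "x \<in> verts G" "\<not> simplicial G x"
    using x by (auto simp: N2_eligible_def)
  then show "{y \<in> verts (local_completion G x). \<not> simplicial (local_completion G x) y}
      \<subset> {y \<in> verts G. \<not> simplicial G y}"
    using simplicial_local_completion[of x G] simplicial_local_completion_self[of x G] by auto
qed

end

theory Submission
  imports Defs "HOL-Library.Multiset"
begin

text \<open>
  Everything reduces to one local completion: if \<open>x\<close> is N2-eligible in \<open>G\<close> and the completion of \<open>G\<close>
  at \<open>x\<close> is Hamiltonian, then so is \<open>G\<close>. Completion only adds edges, so the converse is immediate,
  and the theorem follows by induction along the recursion that defines the closure.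

  Let \<open>X\<close> be the neighborhood class of \<open>x\<close> and \<open>N\<close> its neighborhood. The set \<open>X\<close> is a clique, every
  vertex of \<open>X\<close> is joined to every vertex of \<open>N\<close>, and no edge leaves \<open>X \<union> N\<close> from \<open>X\<close>. Remove from a
  Hamiltonian cycle of the completion the vertices of \<open>X\<close> and the added edges, which all lie
  inside \<open>N\<close>. What remains is a family of disjoint paths of \<open>G\<close> that covers the other vertices and in
  which every path starts and ends in \<open>N\<close> (\<open>cut_into_anchored_paths\<close>). If there are at most \<open>|X|\<close>
  paths in such a family, they close up to a Hamiltonian cycle of \<open>G\<close>, since a vertex of \<open>X\<close> can be
  put between any two consecutive ones (\<open>interleave_paths\<close>).

  It remains to bring the number of paths down to \<open>|N| - min(\<sigma>(N), 2)\<close>, which is at most \<open>|X|\<close> by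
  eligibility. Take a family with as few paths as possible (\<open>path_system_le\<close>). Then no edge joins
  ends of two different paths. If the family were too large, the surplus of vertices of \<open>N\<close> over paths
  would be less than \<open>min(\<sigma>(N), 2)\<close>, hence at most 1, so no path could contain a vertex of \<open>N\<close> other
  than its ends. Every edge inside \<open>N\<close> would then join the two ends of a single path, and each such
  path adds 1 to the surplus; so the surplus would be at least \<open>\<sigma>(N)\<close>, a contradiction.
\<close>

section \<open>Cycles as closed walks\<close>

abbreviation adj :: "'a graph \<Rightarrow> 'a \<Rightarrow> 'a \<Rightarrow> bool" where
  "adj G u v \<equiv> {u, v} \<in> edges G"

lemma adj_commute: "adj G u v \<longleftrightarrow> adj G v u"
  by (simp add: insert_commute)

lemma is_cycle_iff_successively:
  "is_cycle G vs \<longleftrightarrow> length vs \<ge> 3 \<and> distinct vs \<and> set vs \<subseteq> verts G \<and>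
     successively (adj G) vs \<and> adj G (last vs) (hd vs)"
proof (cases "length vs \<ge> 3")
  case True
  then have ne: "vs \<noteq> []" by auto
  have "(\<forall>i < length vs. adj G (vs ! i) (vs ! (Suc i mod length vs))) \<longleftrightarrow>
        (\<forall>i. Suc i < length vs \<longrightarrow> adj G (vs ! i) (vs ! Suc i)) \<and> adj G (last vs) (hd vs)"
    (is "?L \<longleftrightarrow> ?R")
  proof
    assume L: ?L
    show ?R
    proof (intro conjI allI impI)
      fix i assume "Suc i < length vs"
      then show "adj G (vs ! i) (vs ! Suc i)"
        using L[rule_format, of i] by simp
    next
      show "adj G (last vs) (hd vs)"
        using L[rule_format, of "length vs - 1"] ne by (simp add: last_conv_nth hd_conv_nth)
    qed
  next
    assume R: ?R
    show ?L
    proof (intro allI impI)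
      fix i assume i: "i < length vs"
      show "adj G (vs ! i) (vs ! (Suc i mod length vs))"
      proof (cases "Suc i < length vs")
        case True
        then show ?thesis using R by simp
      next
        case False
        then have "Suc i = length vs" using i by simp
        moreover from this have "i = length vs - 1" by simp
        ultimately show ?thesis using R ne by (simp add: last_conv_nth hd_conv_nth)
      qed
    qed
  qed
  then show ?thesis
    by (simp add: is_cycle_def successively_conv_nth)
qed (simp add: is_cycle_def)

lemma rotate_cycle_to:
  assumes "is_cycle G vs" "x \<in> set vs"
  obtains ws where "is_cycle G (x # ws)" "set (x # ws) = set vs"
proof -
  obtain as bs where vs: "vs = as @ x # bs"
    using assms(2) by (meson split_list)
  have "is_cycle G (x # bs @ as)"
    using assms(1) unfolding vs is_cycle_iff_successively
    by (cases "as = []"; cases "bs = []") (auto simp: successively_append_iff successively_Cons)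
  then show ?thesis
    using that[of "bs @ as"] vs by auto
qed

section \<open>Path systems with ends in a given set\<close>

definition anchored_path :: "'a graph \<Rightarrow> 'a set \<Rightarrow> 'a list \<Rightarrow> bool" where
  "anchored_path G N P \<longleftrightarrow>
     P \<noteq> [] \<and> distinct P \<and> successively (adj G) P \<and> hd P \<in> N \<and> last P \<in> N"

definition path_system :: "'a graph \<Rightarrow> 'a set \<Rightarrow> 'a set \<Rightarrow> 'a list set \<Rightarrow> bool" where
  "path_system G A N \<P> \<longleftrightarrow> finite \<P> \<and> (\<Union>P\<in>\<P>. set P) = A \<and>
     pairwise (\<lambda>P Q. disjnt (set P) (set Q)) \<P> \<and> (\<forall>P\<in>\<P>. anchored_path G N P)"

lemma anchored_path_singleton [simp]: "anchored_path G N [u] \<longleftrightarrow> u \<in> N"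
  by (simp add: anchored_path_def)

lemma anchored_path_rev: "anchored_path G N (rev P) \<longleftrightarrow> anchored_path G N P"
  by (auto simp: anchored_path_def hd_rev last_rev insert_commute elim!: successively_mono)

lemma anchored_path_append:
  assumes "anchored_path G N P" "anchored_path G N Q" "disjnt (set P) (set Q)"
    "adj G (last P) (hd Q)"
  shows "anchored_path G N (P @ Q)"
  using assms by (auto simp: anchored_path_def successively_append_iff disjnt_def)

lemma anchored_path_last_at:
  assumes "anchored_path G N P" "u \<in> {hd P, last P}"
  obtains P' where "anchored_path G N P'" "set P' = set P" "last P' = u"
proof (cases "u = last P")
  case True
  then show ?thesis using that assms(1) by blast
next
  case False
  then show ?thesis
    using that[of "rev P"] assms by (auto simp: anchored_path_rev last_rev)
qed

text \<open>
  Reversing the paths if necessary, an edge between ends of two different paths joins the last vertex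
  of one to the first vertex of the other, and the two become one path with ends still in \<open>N\<close>.
\<close>

lemma path_system_merge:
  assumes ps: "path_system G A N \<P>"
    and PQ: "P \<in> \<P>" "Q \<in> \<P>" "P \<noteq> Q"
    and uv: "u \<in> {hd P, last P}" "v \<in> {hd Q, last Q}" "adj G u v"
  obtains \<P>' where "path_system G A N \<P>'" "card \<P>' < card \<P>"
proof -
  have fin: "finite \<P>" and un: "(\<Union>P\<in>\<P>. set P) = A"
    and dj: "pairwise (\<lambda>P Q. disjnt (set P) (set Q)) \<P>"
    and sp: "\<And>P. P \<in> \<P> \<Longrightarrow> anchored_path G N P"
    using ps by (auto simp: path_system_def)
  obtain P' where P': "anchored_path G N P'" "set P' = set P" "last P' = u"
    using anchored_path_last_at sp PQ(1) uv(1) by metis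
  obtain Q' where Q': "anchored_path G N Q'" "set Q' = set Q" "last Q' = v"
    using anchored_path_last_at sp PQ(2) uv(2) by metis
  define R where "R = P' @ rev Q'"
  have "disjnt (set P) (set Q)"
    using dj PQ by (auto simp: pairwise_def)
  then have R: "anchored_path G N R"
    unfolding R_def using P' Q' uv(3)
    by (intro anchored_path_append) (auto simp: anchored_path_rev hd_rev)
  have setR: "set R = set P \<union> set Q"
    using P' Q' by (simp add: R_def)
  let ?\<P> = "insert R (\<P> - {P, Q})"
  have "path_system G A N ?\<P>"
    unfolding path_system_def
  proof (intro conjI)
    show "(\<Union>P\<in>?\<P>. set P) = A"
      using un PQ setR by auto
    show "pairwise (\<lambda>P Q. disjnt (set P) (set Q)) ?\<P>"
      using dj PQ setR by (auto simp: pairwise_insert pairwise_def disjnt_Un1 disjnt_Un2)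
  qed (use fin sp R in auto)
  moreover have "card ?\<P> < card \<P>"
  proof -
    have "card {P, Q} \<le> card \<P>"
      using PQ fin by (intro card_mono) auto
    then have "card (\<P> - {P, Q}) + 2 = card \<P>"
      using PQ fin by (subst card_Diff_subset) auto
    moreover have "card ?\<P> \<le> Suc (card (\<P> - {P, Q}))"
      by (rule card_insert_le_m1) auto
    ultimately show ?thesis by linarith
  qed
  ultimately show ?thesis by (rule that)
qed

text \<open>
  The two ends of a nontrivial path already account for two vertices of \<open>N\<close>, and a trivial path
  has no further vertex.
\<close>

lemma anchored_path_ends:
  assumes P: "anchored_path G N P" and c: "card (set P \<inter> N) \<le> 2"
    and u: "u \<in> set P" "u \<in> N"
  shows "u \<in> {hd P, last P}"
proof (rule ccontr)
  assume n: "u \<notin> {hd P, last P}"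
  have "hd P \<noteq> last P"
  proof (cases P)
    case (Cons a Q)
    then show ?thesis
      using P n u by (cases "Q = []") (auto simp: anchored_path_def)
  qed (use u in simp)
  then have "card {hd P, last P, u} = 3"
    using n by auto
  moreover have "card {hd P, last P, u} \<le> card (set P \<inter> N)"
    using P u by (intro card_mono) (auto simp: anchored_path_def)
  ultimately show False using c by simp
qed

text \<open>
  The extremal step. In a family with the fewest paths, an edge inside \<open>N\<close> between ends of
  different paths would allow a merge. The bound 2 on the number of edges that count is what makes this
  work: a path with three vertices of \<open>N\<close> already creates a surplus of 2, so if the inequality fails
  then all vertices of \<open>N\<close> are ends of paths.
\<close>

lemma path_system_le:
  assumes G: "simple_graph G" and fin: "finite N" and NA: "N \<subseteq> A"
    and ex: "path_system G A N \<P>\<^sub>0"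
  obtains \<P> where "path_system G A N \<P>" "card \<P> + min (sigma G N) 2 \<le> card N"
proof -
  obtain \<P> where ps: "path_system G A N \<P>"
    and least: "\<And>\<P>'. path_system G A N \<P>' \<Longrightarrow> card \<P> \<le> card \<P>'"
    using ex_has_least_nat[of "path_system G A N" \<P>\<^sub>0 card] ex by blast
  have finP: "finite \<P>" and un: "(\<Union>P\<in>\<P>. set P) = A"
    and dj: "pairwise (\<lambda>P Q. disjnt (set P) (set Q)) \<P>"
    and sp: "\<And>P. P \<in> \<P> \<Longrightarrow> anchored_path G N P"
    using ps by (auto simp: path_system_def)
  (* The number of vertices of N on a path; it is at least 1, and the sum of the numbers c P - 1 is
     the surplus of vertices of N over paths. *)
  define c where "c P = card (set P \<inter> N)" for P
  have c1: "c P \<ge> 1" if "P \<in> \<P>" for P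
  proof -
    have "hd P \<in> set P \<inter> N" using sp[OF that] by (auto simp: anchored_path_def)
    then show ?thesis unfolding c_def by (metis One_nat_def Suc_leI card_gt_0_iff empty_iff finite_Int finite_set)
  qed
  have "N = (\<Union>P\<in>\<P>. set P \<inter> N)"
    using un NA by auto
  also have "card \<dots> = (\<Sum>P\<in>\<P>. c P)"
    unfolding c_def using finP dj
    by (intro card_UN_disjoint) (auto simp: pairwise_def disjnt_def)
  also have "\<dots> = (\<Sum>P\<in>\<P>. (c P - 1) + 1)"
    by (intro sum.cong refl) (metis c1 le_add_diff_inverse2)
  finally have "card N = (\<Sum>P\<in>\<P>. (c P - 1) + 1)" .
  then have cardN: "card N = (\<Sum>P\<in>\<P>. c P - 1) + card \<P>"
    by (simp only: sum.distrib) simp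
  have "card \<P> + min (sigma G N) 2 \<le> card N"
  proof (rule ccontr)
    assume "\<not> ?thesis"
    then have excess: "(\<Sum>P\<in>\<P>. c P - 1) < min (sigma G N) 2"
      using cardN by linarith
    have c2: "c P \<le> 2" if "P \<in> \<P>" for P
    proof -
      have "c P - 1 \<le> (\<Sum>P\<in>\<P>. c P - 1)"
        using that finP by (intro member_le_sum) auto
      then show ?thesis using excess by linarith
    qed
    have ends: "u \<in> {hd P, last P}" if "P \<in> \<P>" "u \<in> set P" "u \<in> N" for P u
      using anchored_path_ends[OF sp] c2 that by (auto simp: c_def)
    (* An edge inside N is determined by the path whose two ends it joins, so there are at most as
       many such edges as paths with two vertices of N. *)
    have "induced_edges G N \<subseteq> (\<lambda>P. {hd P, last P}) ` {P \<in> \<P>. c P \<ge> 2}"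
    proof
      fix e assume e: "e \<in> induced_edges G N"
      then obtain u v where uv: "e = {u, v}" "u \<noteq> v" "adj G u v" "u \<in> N" "v \<in> N"
        using G by (force simp: induced_edges_def simple_graph_def card_2_iff)
      obtain P where P: "P \<in> \<P>" "u \<in> set P" using uv un NA by blast
      obtain Q where Q: "Q \<in> \<P>" "v \<in> set Q" using uv un NA by blast
      have "P = Q"
      proof (rule ccontr)
        assume "P \<noteq> Q"
        then obtain \<P>' where "path_system G A N \<P>'" "card \<P>' < card \<P>"
          using path_system_merge[OF ps P(1) Q(1)] ends P Q uv by metis
        then show False using least by fastforce
      qed
      then have "e = {hd P, last P}"
        using uv ends[OF P] ends[OF Q] by auto
      moreover have "c P \<ge> 2"
        using card_mono[of "set P \<inter> N" "{u, v}"] uv P Q \<open>P = Q\<close> by (auto simp: c_def)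
      ultimately show "e \<in> (\<lambda>P. {hd P, last P}) ` {P \<in> \<P>. c P \<ge> 2}"
        using P by auto
    qed
    then have "sigma G N \<le> card {P \<in> \<P>. c P \<ge> 2}"
      unfolding sigma_def using finP by (intro surj_card_le) auto
    also have "\<dots> = (\<Sum>P\<in>{P \<in> \<P>. c P \<ge> 2}. 1)"
      by simp
    also have "\<dots> \<le> (\<Sum>P\<in>{P \<in> \<P>. c P \<ge> 2}. c P - 1)"
      by (intro sum_mono) auto
    also have "\<dots> \<le> (\<Sum>P\<in>\<P>. c P - 1)"
      using finP by (intro sum_mono2) auto
    finally show False using excess by simp
  qed
  then show ?thesis using that ps by blast
qed

section \<open>From a cycle of the completed graph to a cycle of the original graph\<close>

text \<open>
  Here \<open>H\<close> is the completed graph. A cut is made at vertices of \<open>X\<close> and at edges of \<open>H\<close> that are not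
  in \<open>G\<close>; both leave only vertices of \<open>N\<close> at the new ends. The induction builds
  the walk from its last vertex backwards, and the front vertex may still become an inner vertex of a
  path; hence the current piece \<open>Q\<close>, whose start need not lie in \<open>N\<close>.
\<close>

lemma cut_into_anchored_paths:
  assumes "successively (adj H) ws" "distinct ws" "ws \<noteq> []" "last ws \<in> X \<union> N"
    and "X \<inter> N = {}"
    and HX: "\<And>u v. adj H u v \<Longrightarrow> u \<in> X \<Longrightarrow> v \<in> X \<union> N"
    and HN: "\<And>u v. adj H u v \<Longrightarrow> \<not> adj G u v \<Longrightarrow> u \<in> N \<and> v \<in> N"
  shows "\<exists>Q Ps. concat (Q # Ps) = filter (\<lambda>u. u \<notin> X) ws \<and> list_all (anchored_path G N) Ps \<and>
    (if hd ws \<in> X then Q = [] else anchored_path G (insert (hd ws) N) Q \<and> hd Q = hd ws \<and> last Q \<in> N)"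
  using assms(1-4)
proof (induction ws)
  case (Cons u ws)
  show ?case
  proof (cases "ws = []")
    case True
    show ?thesis
      by (rule exI[of _ "if u \<in> X then [] else [u]"], rule exI[of _ "[]"])
        (use True Cons.prems in \<open>auto simp: anchored_path_def\<close>)
  next
    case False
    have uv: "adj H u (hd ws)"
      using Cons.prems False by (auto simp: successively_Cons)
    obtain Q Ps where cc: "concat (Q # Ps) = filter (\<lambda>u. u \<notin> X) ws"
      and Ps: "list_all (anchored_path G N) Ps"
      and Q: "if hd ws \<in> X then Q = []
        else anchored_path G (insert (hd ws) N) Q \<and> hd Q = hd ws \<and> last Q \<in> N"
      using Cons False by (auto simp: successively_Cons)
    have QN: "anchored_path G N Q" if "hd ws \<in> N"
      using that Q assms(5) by (auto simp: insert_absorb split: if_splits)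
    consider (inX) "u \<in> X" | (nextX) "u \<notin> X" "hd ws \<in> X"
      | (cut) "u \<notin> X" "hd ws \<notin> X" "\<not> adj G u (hd ws)" | (keep) "u \<notin> X" "hd ws \<notin> X" "adj G u (hd ws)"
      by blast
    then show ?thesis
    proof cases
      case inX
      show ?thesis
      proof (cases "hd ws \<in> X")
        case True
        then show ?thesis
          using inX cc Ps Q by (intro exI[of _ "[]"] exI[of _ Ps]) simp
      next
        case False
        then have "hd ws \<in> N" using HX[OF uv inX] by simp
        then show ?thesis
          using inX cc Ps QN by (intro exI[of _ "[]"] exI[of _ "Q # Ps"]) simp
      qed
    next
      case nextX
      then have "u \<in> N"
        using HX[of "hd ws" u] uv adj_commute[of u _ H] by blast
      then show ?thesis
        using nextX cc Ps Q
        by (intro exI[of _ "[u]"] exI[of _ Ps]) simp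
    next
      case cut
      then have "u \<in> N" "hd ws \<in> N" using HN[OF uv] by auto
      then show ?thesis
        using cut cc Ps QN
        by (intro exI[of _ "[u]"] exI[of _ "Q # Ps"]) simp
    next
      case keep
      have "set Q \<subseteq> set ws"
        using arg_cong[OF cc, of set] by auto
      then have "u \<notin> set Q" using Cons.prems by auto
      then have "anchored_path G (insert u N) (u # Q) \<and> last (u # Q) \<in> N"
        using keep Q by (auto simp: anchored_path_def successively_Cons)
      then show ?thesis
        using keep cc Ps by (intro exI[of _ "u # Q"] exI[of _ Ps]) simp
    qed
  qed
qed simp

text \<open>
  One vertex of \<open>xs\<close> follows each path, and the surplus vertices follow the last path. The
  resulting walk starts in \<open>N\<close> and ends in \<open>xs\<close>, so it closes up to a cycle.
\<close>

lemma interleave_paths: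
  assumes "Ps \<noteq> []" "list_all (anchored_path G N) Ps" "length Ps \<le> length xs"
    and "\<And>x y. x \<in> set xs \<Longrightarrow> y \<in> set xs \<union> N \<Longrightarrow> x \<noteq> y \<Longrightarrow> adj G x y"
    and "distinct xs" "set xs \<inter> N = {}"
  shows "\<exists>zs. mset zs = mset (concat Ps @ xs) \<and> successively (adj G) zs \<and>
    zs \<noteq> [] \<and> hd zs \<in> N \<and> last zs \<in> set xs"
  using assms
proof (induction Ps arbitrary: xs)
  case (Cons P Ps)
  have P: "anchored_path G N P" using Cons.prems by simp
  obtain x ys where xs: "xs = x # ys"
    using Cons.prems by (cases xs) auto
  have lastP: "adj G (last P) x"
    using P Cons.prems(4)[of x "last P"] Cons.prems(6) xs
    by (auto simp: anchored_path_def insert_commute)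
  show ?case
  proof (cases "Ps = []")
    case True
    have "successively (adj G) xs"
      unfolding successively_conv_nth
    proof (intro allI impI)
      fix i assume "Suc i < length xs"
      then show "adj G (xs ! i) (xs ! Suc i)"
        using Cons.prems(5) by (intro Cons.prems(4)) (auto simp: nth_eq_iff_index_eq)
    qed
    then show ?thesis
      using P lastP xs True
      by (intro exI[of _ "P @ xs"]) (auto simp: anchored_path_def successively_append_iff)
  next
    case False
    then obtain zs where zs: "mset zs = mset (concat Ps @ ys)" "successively (adj G) zs"
      "zs \<noteq> []" "hd zs \<in> N" "last zs \<in> set ys"
      using Cons.IH[of ys] Cons.prems unfolding xs by auto
    have "adj G x (hd zs)"
      using Cons.prems(4)[of x "hd zs"] Cons.prems(6) zs xs by auto
    then show ?thesis
      using P lastP xs zs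
      by (intro exI[of _ "P @ x # zs"])
        (auto simp: anchored_path_def successively_append_iff successively_Cons)
  qed
qed simp

text \<open>
  A clique \<open>X\<close> that is completely joined to \<open>N\<close> and to nothing else is a supply of connectors, so
  it suffices to cover the other vertices by at most \<open>|X|\<close> paths. Cutting the given cycle yields some
  path system, and merging brings it down to that size.
\<close>

theorem hamiltonian_of_completed:
  assumes G: "simple_graph G" and H: "verts H = verts G" "hamiltonian H"
    and XN: "X \<noteq> {}" "X \<subseteq> verts G" "N \<subseteq> verts G" "X \<inter> N = {}" "2 \<le> card N"
    and GX: "\<And>x y. x \<in> X \<Longrightarrow> y \<in> X \<union> N \<Longrightarrow> x \<noteq> y \<Longrightarrow> adj G x y"
    and HX: "\<And>u v. adj H u v \<Longrightarrow> u \<in> X \<Longrightarrow> v \<in> X \<union> N"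
    and HN: "\<And>u v. adj H u v \<Longrightarrow> \<not> adj G u v \<Longrightarrow> u \<in> N \<and> v \<in> N"
    and large: "card N \<le> card X + min (sigma G N) 2"
  shows "hamiltonian G"
proof -
  have "finite (verts G)" using G by (simp add: simple_graph_def)
  then have fin: "finite (verts G)" "finite X" "finite N"
    using finite_subset[OF XN(2)] finite_subset[OF XN(3)] by simp_all
  let ?A = "verts G - X"
  (* Starting the cycle in X makes its last vertex a neighbor of X, hence a vertex of X or N, so that
     the last piece cut off ends properly. *)
  obtain x where x: "x \<in> X" using XN by blast
  obtain vs where vs: "is_cycle H vs" "set vs = verts G"
    using H by (auto simp: hamiltonian_def)
  have "x \<in> set vs" using x XN(2) vs(2) by auto
  then obtain ws where ws: "is_cycle H (x # ws)" "set (x # ws) = verts G"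
    using rotate_cycle_to[OF vs(1)] vs(2) by metis
  have "adj H (last (x # ws)) x" using ws(1) unfolding is_cycle_iff_successively by simp
  then have "last (x # ws) \<in> X \<union> N"
    using HX[of x "last (x # ws)"] x adj_commute[of x _ H] by blast
  then have "\<exists>Q Ps. concat (Q # Ps) = filter (\<lambda>u. u \<notin> X) (x # ws) \<and>
      list_all (anchored_path G N) Ps \<and>
      (if hd (x # ws) \<in> X then Q = []
       else anchored_path G (insert (hd (x # ws)) N) Q \<and> hd Q = hd (x # ws) \<and> last Q \<in> N)"
    using ws(1) unfolding is_cycle_iff_successively
    by (intro cut_into_anchored_paths[where H = H, OF _ _ _ _ XN(4) HX HN]) auto
  then obtain Ps where Ps: "concat Ps = filter (\<lambda>u. u \<notin> X) (x # ws)"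
    "list_all (anchored_path G N) Ps"
    using x that by auto
  have "path_system G ?A N (set Ps)"
    unfolding path_system_def
  proof (intro conjI)
    show "(\<Union>P\<in>set Ps. set P) = ?A"
      using arg_cong[OF Ps(1), of set] ws(2) by auto
    have "distinct (concat Ps)"
      unfolding Ps(1) using ws(1) by (auto simp: is_cycle_def)
    then show "pairwise (\<lambda>P Q. disjnt (set P) (set Q)) (set Ps)"
      by (auto simp: distinct_concat_iff pairwise_def disjnt_def)
  qed (use Ps in \<open>auto simp: list_all_iff\<close>)
  then obtain \<P> where ps: "path_system G ?A N \<P>" "card \<P> + min (sigma G N) 2 \<le> card N"
    using path_system_le[OF G fin(3), of ?A] XN by blast
  obtain Qs where Qs: "set Qs = \<P>" "distinct Qs"
    using ps(1) finite_distinct_list unfolding path_system_def by metis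
  obtain xs where xs: "set xs = X" "distinct xs"
    using fin(2) finite_distinct_list by blast
  have "N \<noteq> {}" using XN(5) by auto
  then have "?A \<noteq> {}" using XN(3,4) by blast
  then have "Qs \<noteq> []"
    using ps(1) Qs by (auto simp: path_system_def)
  moreover have "length Qs \<le> length xs"
    using ps(2) large Qs xs distinct_card by (metis add_le_cancel_right le_trans)
  moreover have "list_all (anchored_path G N) Qs"
    using ps(1) Qs by (auto simp: path_system_def list_all_iff)
  ultimately obtain zs where zs: "mset zs = mset (concat Qs @ xs)" "successively (adj G) zs"
    "zs \<noteq> []" "hd zs \<in> N" "last zs \<in> X"
    using interleave_paths[of Qs G N xs, unfolded xs(1), OF _ _ _ GX xs(2) XN(4)] by blast
  have setQs: "set (concat Qs) = ?A"
    using ps(1) Qs by (auto simp: path_system_def)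
  have setzs: "set zs = verts G"
  proof -
    have "set zs = set (concat Qs) \<union> set xs"
      using arg_cong[OF zs(1), of set_mset] by simp
    then show ?thesis using setQs xs(1) XN(2) by auto
  qed
  have "distinct (concat Qs)"
    using ps(1) Qs
    by (auto simp: path_system_def distinct_concat_iff pairwise_def disjnt_def anchored_path_def
      removeAll_filter_not_eq)
  then have "distinct (concat Qs @ xs)"
    using xs(2) unfolding distinct_append setQs xs(1) by blast
  then have dist: "distinct zs"
    using zs(1) mset_eq_imp_distinct_iff by blast
  have "card (X \<union> N) \<le> card (verts G)"
    using XN fin by (intro card_mono) auto
  moreover have "card X \<ge> 1"
    using XN fin by (simp add: Suc_leI card_gt_0_iff)
  ultimately have "3 \<le> length zs"
    using distinct_card[OF dist] setzs XN fin by (simp add: card_Un_disjoint)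
  moreover have "adj G (last zs) (hd zs)"
    using zs(4,5) XN(4) by (intro GX) auto
  ultimately have "is_cycle G zs"
    unfolding is_cycle_iff_successively using dist setzs zs(2) by simp
  then show ?thesis
    unfolding hamiltonian_def using setzs by blast
qed

section \<open>The closure\<close>

text \<open>
  All vertices of the class have the same closed neighborhood, which gives the complete adjacency of
  the class to itself and to its neighborhood. As \<open>x\<close> is not simplicial, some two vertices
  of its closed neighborhood are not adjacent, and both must lie outside the class.
\<close>

theorem hamiltonian_local_completion_iff:
  assumes G: "simple_graph G" and x: "N2_eligible G x"
  shows "hamiltonian (local_completion G x) \<longleftrightarrow> hamiltonian G"
proof
  assume "hamiltonian G"
  then show "hamiltonian (local_completion G x)"
    by (auto simp: hamiltonian_def is_cycle_def local_completion_def)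
next
  assume ham: "hamiltonian (local_completion G x)"
  define X where "X = nbhd_class G x"
  define N where "N = nbhd_set G X"
  have xV: "x \<in> verts G" and ns: "\<not> simplicial G x"
    and large: "card N \<le> card X + min (sigma G N) 2"
    using x by (auto simp: N2_eligible_def chi2_def X_def N_def)
  have N: "N = closed_nbhd G x - X"
    unfolding N_def X_def by (rule nbhd_set_nbhd_class[OF xV])
  have xX: "x \<in> X" using xV by (simp add: X_def nbhd_class_def)
  have cl: "closed_nbhd G y = X \<union> N" if "y \<in> X" for y
  proof -
    have "X \<subseteq> closed_nbhd G x"
      by (auto simp: X_def nbhd_class_def closed_nbhd_def)
    then show ?thesis using that unfolding N by (auto simp: X_def nbhd_class_def)
  qed
  have adjX: "adj G y z" if "y \<in> X" "z \<in> X \<union> N" "y \<noteq> z" for y z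
    using cl[OF that(1)] that by (auto simp: closed_nbhd_def nbhd_def)
  have XV: "X \<subseteq> verts G" by (auto simp: X_def nbhd_class_def)
  have NV: "N \<subseteq> verts G"
    using nbhd_subset_verts[OF G, of x] xV unfolding N closed_nbhd_def by auto
  have finN: "finite N"
    using NV G finite_subset by (auto simp: simple_graph_def)
  obtain u v where uv: "u \<in> X \<union> N" "v \<in> X \<union> N" "u \<noteq> v" "\<not> adj G u v"
    using ns cl[OF xX] by (auto simp: simplicial_def is_clique_def)
  then have "{u, v} \<subseteq> N"
    using adjX[of u v] adjX[of v u] adj_commute[of u v G] by auto
  then have cardN: "2 \<le> card N"
    using card_mono[OF finN, of "{u, v}"] uv(3) by simp
  show "hamiltonian G"
  proof (rule hamiltonian_of_completed[OF G _ ham _ XV NV _ cardN adjX _ _ large])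
    show "b \<in> X \<union> N" if "adj (local_completion G x) a b" "a \<in> X" for a b
      using that cl[OF that(2)] N
      by (auto simp: edge_local_completion_iff closed_nbhd_def nbhd_def X_def[symmetric] N_def[symmetric])
    show "a \<in> N \<and> b \<in> N" if "adj (local_completion G x) a b" "\<not> adj G a b" for a b
      using that by (auto simp: edge_local_completion_iff X_def N_def)
  qed (use xX N in auto)
qed

lemma hamiltonian_N2_closure_iff:
  assumes "simple_graph G" "choice_function (verts G) \<rho>"
  shows "hamiltonian (N2_closure \<rho> G) \<longleftrightarrow> hamiltonian G"
  using assms
proof (induction "card {y \<in> verts G. \<not> simplicial G y}" arbitrary: G rule: less_induct)
  case less
  show ?case
  proof (cases "\<exists>x. N2_eligible G x")
    case True
    define x where "x = \<rho> {x. N2_eligible G x}"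
    have "{x. N2_eligible G x} \<subseteq> verts G" "{x. N2_eligible G x} \<noteq> {}"
      using True by (auto simp: N2_eligible_def)
    then have x: "N2_eligible G x"
      using less.prems(2) unfolding choice_function_def x_def by blast
    have "N2_closure \<rho> G = N2_closure \<rho> (local_completion G x)"
      using True by (subst N2_closure.simps) (auto simp: x_def)
    also have "hamiltonian \<dots> \<longleftrightarrow> hamiltonian (local_completion G x)"
      using less.prems x card_non_simplicial_local_completion[OF less.prems(1) x]
      by (intro less.hyps) (auto simp: N2_eligible_def intro: simple_graph_local_completion)
    also have "\<dots> \<longleftrightarrow> hamiltonian G"
      by (rule hamiltonian_local_completion_iff[OF less.prems(1) x])
    finally show ?thesis .
  next
    case False
    then show ?thesis by (subst N2_closure.simps) auto
  qed
qed

theorem corollary18: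
  fixes G :: "'a graph" and \<rho> :: "'a set \<Rightarrow> 'a"
  assumes "simple_graph G"
    and "connected_graph G"
    and "choice_function (verts G) \<rho>"
  shows "\<forall>\<rho>'. choice_function (verts G) \<rho>' \<longrightarrow>
           (hamiltonian (N2_closure \<rho> G) \<longleftrightarrow> hamiltonian G) \<and>
           (hamiltonian G \<longleftrightarrow> hamiltonian (N2_closure \<rho>' G))"
  using hamiltonian_N2_closure_iff assms by blast

end
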